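(* Let $A,B,C$ be three non-collinear points in the Euclidean plane, and let $x,y,z,u,v,w\in\mathbb{R}\cup\{\infty\}$ be such that each of the pairs of cevians $(AA_x,BB_v)$, $(BB_y,CC_w)$, $(CC_z,AA_u)$ intersects at exactly one point (equivalently, $(1+x+xv)(1+y+yw)(1+z+zu)\neq 0$, with the convention for $\infty$ given in the context). Define the points $P,Q,R$ by $$\{P\}=AA_x\cap BB_v,\qquad \{Q\}=BB_y\cap CC_w,\qquad \{R\}=CC_z\cap AA_u .$$ Let $\Delta_1$ be the signed area of the triangle $PQR$ and $\Delta$ the signed area of the triangle $ABC$. Then $$\frac{\Delta_1}{\Delta}=\frac{1-xyw-xvz-uyz+xyz+xyzuvw}{(1+x+xv)(1+y+yw)(1+z+zu)},$$ where, if some of the parameters equal $\infty$, the right-hand side is understood as the value at $(x,y,z,u,v,w)$ of its extension by continuity from the real $6$-tuples at which the denominator is nonzero.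
   Context: Cevians. Let $A,B,C$ be non-collinear points in the Euclidean plane. For $x\in\mathbb{R}\setminus\{-1\}$, $A_x$ is the unique point on the line $BC$ with $\overrightarrow{BA_x}=x\,\overrightarrow{A_xC}$ (so $A_0=B$), and $A_\infty=C$. For $x\in(\mathbb{R}\cup\{\infty\})\setminus\{-1\}$, $AA_x$ denotes the line through $A$ and $A_x$; $AA_{-1}$ denotes the line through $A$ parallel to $BC$. Similarly, for $y\in\mathbb{R}\setminus\{-1\}$, $B_y$ is the unique point on the line $CA$ with $\overrightarrow{CB_y}=y\,\overrightarrow{B_yA}$ (so $B_0=C$), $B_\infty=A$, $BB_y$ is the line through $B$ and $B_y$, and $BB_{-1}$ is the line through $B$ parallel to $CA$. For $z\in\mathbb{R}\setminus\{-1\}$, $C_z$ is the unique point on the line $AB$ with $\overrightarrow{AC_z}=z\,\overrightarrow{C_zB}$ (so $C_0=A$), $C_\infty=B$, $CC_z$ is the line through $C$ and $C_z$, and $CC_{-1}$ is the line through $C$ parallel to $AB$. All these lines are called cevians. Convention for $\infty$. $\mathbb{R}\cup\{\infty\}$ carries the topology of the one-point compactification of $\mathbb{R}$. For $s,t\in\mathbb{R}\cup\{\infty\}$ not both real, $1+s+st=0$ is considered to hold exactly when $(s,t)=(\infty,-1)$ or $(s,t)=(0,\infty)$ (these are the points with an infinite entry in the closure of the real solution set). The condition $(1+x+xv)(1+y+yw)(1+z+zu)\neq0$ means that none of the three factors vanishes in this sense. Areas. All areas of triangles are signed: positive if the vertices, taken in the listed (alphabetical) order, run counterclockwise, negative for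 the opposite orientation, and $0$ if the three vertices are collinear (possibly coinciding). *)

theory Defs
  imports "HOL-Analysis.Analysis"
begin

(* Elements of R + {infinity}: None is infinity, Some t is the real number t. *)
type_synonym xreal = "real option"

(* The cyclic shift (A, B, C) -> (B, C, A) turns A_s into B_s and B_s into C_s, so one definition,
   depending on the two endpoints of the opposite side, serves all three families.
   For Some t only t \<noteq> - 1 is meaningful. *)
definition cevian_foot :: "real^2 \<Rightarrow> real^2 \<Rightarrow> xreal \<Rightarrow> real^2" where
  "cevian_foot B C s =
     (case s of
        None \<Rightarrow> C
      | Some t \<Rightarrow> (THE D. D \<in> affine hull {B, C} \<and> D - B = t *\<^sub>R (C - D)))"

(* AA_x, BB_y, CC_z are cevian A B C x, cevian B C A y, cevian C A B z, respectively. *)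
definition cevian :: "real^2 \<Rightarrow> real^2 \<Rightarrow> real^2 \<Rightarrow> xreal \<Rightarrow> (real^2) set" where
  "cevian A B C s =
     (if s = Some (- 1) then {A + r *\<^sub>R (C - B) | r. True}
      else affine hull {A, cevian_foot B C s})"

(* Positive iff P, Q, R run counterclockwise, zero iff they are collinear. *)
definition orientation :: "real^2 \<Rightarrow> real^2 \<Rightarrow> real^2 \<Rightarrow> real" where
  "orientation P Q R =
     sgn ((Q$1 - P$1) * (R$2 - P$2) - (Q$2 - P$2) * (R$1 - P$1))"

definition signed_area :: "real^2 \<Rightarrow> real^2 \<Rightarrow> real^2 \<Rightarrow> real" where
  "signed_area P Q R = orientation P Q R * measure lebesgue (convex hull {P, Q, R})"

(* "1 + s + s t = 0", with the convention for infinite entries. *)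
definition factor_vanishes :: "xreal \<Rightarrow> xreal \<Rightarrow> bool" where
  "factor_vanishes s t \<longleftrightarrow>
     (\<exists>a b. s = Some a \<and> t = Some b \<and> 1 + a + a * b = 0) \<or>
     (s = None \<and> t = Some (- 1)) \<or> (s = Some 0 \<and> t = None)"

(* Parameters are always listed in the order (x, y, z, u, v, w). *)
definition admissible :: "(xreal \<times> xreal \<times> xreal \<times> xreal \<times> xreal \<times> xreal) set" where
  "admissible = {(x, y, z, u, v, w).
     \<not> factor_vanishes x v \<and> \<not> factor_vanishes y w \<and> \<not> factor_vanishes z u}"

definition area_formula :: "real \<Rightarrow> real \<Rightarrow> real \<Rightarrow> real \<Rightarrow> real \<Rightarrow> real \<Rightarrow> real" where
  "area_formula x y z u v w =
     (1 - x * y * w - x * v * z - u * y * z + x * y * z + x * y * z * u * v * w) /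
     ((1 + x + x * v) * (1 + y + y * w) * (1 + z + z * u))"

definition xreal_topology :: "xreal topology" where
  "xreal_topology = Alexandroff_compactification euclideanreal"

definition xreal6_topology ::
    "(xreal \<times> xreal \<times> xreal \<times> xreal \<times> xreal \<times> xreal) topology" where
  "xreal6_topology =
     prod_topology xreal_topology (prod_topology xreal_topology (prod_topology xreal_topology
       (prod_topology xreal_topology (prod_topology xreal_topology xreal_topology))))"

(* G is an extension by continuity of area_formula, from the real 6-tuples with nonzero denominator
   to all admissible 6-tuples; values of G outside admissible are irrelevant. *)
definition extends_area_formula ::
    "(xreal \<times> xreal \<times> xreal \<times> xreal \<times> xreal \<times> xreal \<Rightarrow> real) \<Rightarrow> bool" where
  "extends_area_formula G \<longleftrightarrow>
     continuous_map (subtopology xreal6_topology admissible) euclideanreal G \<and>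
     (\<forall>x y z u v w. (1 + x + x * v) * (1 + y + y * w) * (1 + z + z * u) \<noteq> 0 \<longrightarrow>
        G (Some x, Some y, Some z, Some u, Some v, Some w) = area_formula x y z u v w)"

end

theory Submission
  imports Defs "HOL-Real_Asymp.Real_Asymp"
begin

text \<open>Write the parameter $s$ in homogeneous form as $p/q$. The cevian $AA_s$ is then the line through
  $A$ with direction $q(B-A) + p(C-A)$, for every value of $s$ including $-1$ and $\infty$. Two cevians
  $AA_s$, $BB_t$ with $s = p/q$, $t = p'/q'$ meet in exactly one point iff their directions are linearly
  independent, i.e. iff $pp' + qq' + pq' \neq 0$, and the intersection point then has the barycentric
  coordinates $(pp' : qq' : pq')$. The ratio of the areas is the determinant of the normalized
  barycentric coordinates of $P$, $Q$, $R$. These coordinates are continuous in the parameters because,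
  after multiplying numerator and denominator by $pp' + qq' + pq'$, they are rational functions of the
  continuous functions $p^2/(p^2+q^2)$, $pq/(p^2+q^2)$, $q^2/(p^2+q^2)$ on the projective line.
  The extension by continuity is unique because each $6$-tuple is a limit of real ones, and admissibility is
  inherited by almost all terms of the approximating sequence.\<close>

section \<open>Homogeneous parameters\<close>

definition hnum :: "xreal \<Rightarrow> real" where
  "hnum s = (case s of None \<Rightarrow> 1 | Some t \<Rightarrow> t)"

definition hden :: "xreal \<Rightarrow> real" where
  "hden s = (case s of None \<Rightarrow> 0 | Some t \<Rightarrow> 1)"

lemma hnum_simps [simp]: "hnum None = 1" "hnum (Some t) = t"
  by (auto simp: hnum_def)

lemma hden_simps [simp]: "hden None = 0" "hden (Some t) = 1"
  by (auto simp: hden_def)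

text \<open>The homogenization of 1 + s + s t: for s = p/q and t = p'/q' the factor is multiplied by
  q q'.\<close>

definition hfactor :: "xreal \<Rightarrow> xreal \<Rightarrow> real" where
  "hfactor s t = hnum s * hnum t + hden s * hden t + hnum s * hden t"

lemma hfactor_Some [simp]: "hfactor (Some a) (Some b) = 1 + a + a * b"
  by (simp add: hfactor_def)

text \<open>With an infinite entry the homogeneous form becomes 1 + t for s = \<infinity>, s for t =
  \<infinity>, and 1 for both, which is exactly the convention.\<close>

lemma factor_vanishes_iff: "factor_vanishes s t \<longleftrightarrow> hfactor s t = 0"
  by (cases s; cases t) (auto simp: factor_vanishes_def hfactor_def)

text \<open>The barycentric coordinates, with respect to $A$, $B$, $C$, of the intersection of $AA_s$
  and $BB_t$.\<close>

definition bary1 :: "xreal \<Rightarrow> xreal \<Rightarrow> real" where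
  "bary1 s t = hnum s * hnum t / hfactor s t"

definition bary2 :: "xreal \<Rightarrow> xreal \<Rightarrow> real" where
  "bary2 s t = hden s * hden t / hfactor s t"

definition bary3 :: "xreal \<Rightarrow> xreal \<Rightarrow> real" where
  "bary3 s t = hnum s * hden t / hfactor s t"

lemma bary_sum:
  assumes "hfactor s t \<noteq> 0"
  shows "bary1 s t + bary2 s t + bary3 s t = 1"
  using assms by (simp add: bary1_def bary2_def bary3_def hfactor_def flip: add_divide_distrib)

section \<open>Cevians and their intersections\<close>

definition cross2 :: "real^2 \<Rightarrow> real^2 \<Rightarrow> real" where
  "cross2 d e = d$1 * e$2 - d$2 * e$1"

lemma cross2_eq_0_imp_scaleR:
  assumes "cross2 d e = 0" "d \<noteq> 0"
  obtains k where "e = k *\<^sub>R d"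
proof (cases "d$1 = 0")
  case True
  with assms have "d$2 \<noteq> 0"
    by (simp add: vec_eq_iff forall_2)
  with True assms have "e = (e$2 / d$2) *\<^sub>R d"
    by (auto simp: vec_eq_iff forall_2 cross2_def)
  then show ?thesis by (rule that)
next
  case False
  with assms have "e = (e$1 / d$1) *\<^sub>R d"
    by (auto simp: vec_eq_iff forall_2 cross2_def field_simps)
  then show ?thesis by (rule that)
qed

lemma cross2_triangle_nonzero:
  assumes "\<not> collinear {A, B, C}"
  shows "cross2 (B - A) (C - A) \<noteq> 0"
proof
  assume *: "cross2 (B - A) (C - A) = 0"
  have "A \<noteq> B"
    using assms by auto
  then obtain k where "C - A = k *\<^sub>R (B - A)"
    using cross2_eq_0_imp_scaleR[OF *] by auto
  then have "C = A + k *\<^sub>R (B - A)"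
    by (simp add: algebra_simps)
  then have "C \<in> affine hull {A, B}"
    by (auto simp: affine_hull_2_alt)
  then show False
    using assms affine_hull_3_imp_collinear by blast
qed

lemma cross2_rotate: "cross2 (C - B) (A - B) = cross2 (B - A) (C - A)"
  by (simp add: cross2_def algebra_simps)

text \<open>If the directions were parallel, a common point moved by \<open>d\<close> would remain
  on both lines.\<close>

lemma unique_intersection_imp_cross2_nonzero:
  assumes "d \<noteq> 0" "e \<noteq> 0"
    and "\<exists>!P. P \<in> range (\<lambda>r. A + r *\<^sub>R d) \<inter> range (\<lambda>r. B + r *\<^sub>R e)"
  shows "cross2 d e \<noteq> 0"
proof
  assume "cross2 d e = 0"
  then obtain k where k: "e = k *\<^sub>R d"
    using assms(1) cross2_eq_0_imp_scaleR by blast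
  with assms(2) have "k \<noteq> 0" by auto
  obtain P r r' where P: "P = A + r *\<^sub>R d" "P = B + r' *\<^sub>R e"
    using ex1_implies_ex[OF assms(3)] by blast
  have "P + d = A + (r + 1) *\<^sub>R d"
    using P(1) by (simp add: algebra_simps)
  moreover have "P + d = B + (r' + 1 / k) *\<^sub>R e"
    using P(2) k \<open>k \<noteq> 0\<close> by (simp add: algebra_simps)
  ultimately have "P + d \<in> range (\<lambda>r. A + r *\<^sub>R d) \<inter> range (\<lambda>r. B + r *\<^sub>R e)"
    by blast
  moreover have "P \<in> range (\<lambda>r. A + r *\<^sub>R d) \<inter> range (\<lambda>r. B + r *\<^sub>R e)"
    using P by blast
  ultimately have "P + d = P"
    using assms(3) by blast
  with assms(1) show False by simp
qed

lemma intersection_unique: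
  assumes "cross2 d e \<noteq> 0"
    and "P \<in> range (\<lambda>r. A + r *\<^sub>R d) \<inter> range (\<lambda>r. B + r *\<^sub>R e)"
    and "Q \<in> range (\<lambda>r. A + r *\<^sub>R d) \<inter> range (\<lambda>r. B + r *\<^sub>R e)"
  shows "P = Q"
proof -
  obtain a b where a: "P = A + a *\<^sub>R d" and b: "Q = A + b *\<^sub>R d"
    using assms by blast
  obtain a' b' where a': "P = B + a' *\<^sub>R e" and b': "Q = B + b' *\<^sub>R e"
    using assms by blast
  have "(a - b) *\<^sub>R d = (a' - b') *\<^sub>R e"
    using a b a' b' by (metis add_diff_cancel_left scaleR_left.diff)
  \<comment> \<open>The determinant with \<open>e\<close> kills the right-hand side and isolates
    \<open>a - b\<close>.\<close>
  then have "cross2 ((a - b) *\<^sub>R d) e = cross2 ((a' - b') *\<^sub>R e) e"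
    by simp
  then have "(a - b) * cross2 d e = 0"
    by (simp add: cross2_def algebra_simps)
  with assms(1) a b show ?thesis by simp
qed

section \<open>Cevians as parametrized lines\<close>

definition cevian_dir :: "real^2 \<Rightarrow> real^2 \<Rightarrow> real^2 \<Rightarrow> xreal \<Rightarrow> real^2" where
  "cevian_dir A B C s = hden s *\<^sub>R (B - A) + hnum s *\<^sub>R (C - A)"

text \<open>In each coordinate the defining equation is linear in \<open>D\<close> with leading
  coefficient 1 + t, so it has a single solution for t \<noteq> -1.\<close>

lemma cevian_foot_Some:
  assumes "t \<noteq> - 1"
  shows "cevian_foot B C (Some t) = B + (t / (1 + t)) *\<^sub>R (C - B)"
proof -
  have nz: "1 + t \<noteq> 0"
    using assms by auto
  have "(THE D. D \<in> affine hull {B, C} \<and> D - B = t *\<^sub>R (C - D)) = B + (t / (1 + t)) *\<^sub>R (C - B)"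
  proof (rule the_equality)
    show "B + (t / (1 + t)) *\<^sub>R (C - B) \<in> affine hull {B, C} \<and>
      B + (t / (1 + t)) *\<^sub>R (C - B) - B = t *\<^sub>R (C - (B + (t / (1 + t)) *\<^sub>R (C - B)))"
      using nz by (auto simp: affine_hull_2_alt vec_eq_iff field_simps)
  next
    fix D
    assume "D \<in> affine hull {B, C} \<and> D - B = t *\<^sub>R (C - D)"
    then have eq: "D$i - B$i = t * (C$i - D$i)" for i
      by (metis vector_minus_component vector_scaleR_component real_scaleR_def)
    have "D$i = B$i + t / (1 + t) * (C$i - B$i)" for i
      using eq[of i] nz by (simp add: field_simps)
    then show "D = B + (t / (1 + t)) *\<^sub>R (C - B)"
      by (simp add: vec_eq_iff)
  qed
  then show ?thesis
    by (simp add: cevian_foot_def)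
qed

lemma range_line_scaleR:
  fixes A d :: "'a::real_vector"
  assumes "k \<noteq> 0"
  shows "range (\<lambda>r::real. A + r *\<^sub>R (k *\<^sub>R d)) = range (\<lambda>r. A + r *\<^sub>R d)"
proof (intro subset_antisym image_subsetI)
  show "A + r *\<^sub>R (k *\<^sub>R d) \<in> range (\<lambda>r. A + r *\<^sub>R d)" for r
    by (rule range_eqI[of _ _ "r * k"]) simp
  show "A + r *\<^sub>R d \<in> range (\<lambda>r. A + r *\<^sub>R (k *\<^sub>R d))" for r
    by (rule range_eqI[of _ _ "r / k"]) (use assms in simp)
qed

text \<open>The direction is C - A at infinity, B - C at -1, and otherwise 1 + t times the vector
  from A to the foot; nonzero scalars do not change the line.\<close>

lemma cevian_eq_range: "cevian A B C s = range (\<lambda>r. A + r *\<^sub>R cevian_dir A B C s)"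
proof (cases s)
  case None
  then show ?thesis
    by (simp add: cevian_def cevian_foot_def cevian_dir_def affine_hull_2_alt)
next
  case (Some t)
  show ?thesis
  proof (cases "t = - 1")
    case True
    have "cevian A B C s = range (\<lambda>r. A + r *\<^sub>R (C - B))"
      using Some True by (auto simp: cevian_def)
    also have "\<dots> = range (\<lambda>r. A + r *\<^sub>R ((- 1) *\<^sub>R (C - B)))"
      by (rule range_line_scaleR[symmetric]) simp
    also have "(- 1) *\<^sub>R (C - B) = cevian_dir A B C s"
      using Some True by (simp add: cevian_dir_def)
    finally show ?thesis .
  next
    case False
    then have nz: "1 + t \<noteq> 0" by auto
    have "cevian A B C s = range (\<lambda>r. A + r *\<^sub>R (cevian_foot B C s - A))"
      using Some False by (simp add: cevian_def affine_hull_2_alt)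
    also have "cevian_foot B C s - A = (1 / (1 + t)) *\<^sub>R cevian_dir A B C s"
      using nz by (simp add: Some cevian_foot_Some[OF False] cevian_dir_def vec_eq_iff divide_simps)
        (simp add: algebra_simps)
    finally show ?thesis
      using nz range_line_scaleR[of "1 / (1 + t)"] by simp
  qed
qed

lemma cevian_dir_nonzero:
  assumes "cross2 (B - A) (C - A) \<noteq> 0"
  shows "cevian_dir A B C s \<noteq> 0"
proof
  assume *: "cevian_dir A B C s = 0"
  \<comment> \<open>Determinants with the two sides read off the homogeneous coordinates of s, which
    never vanish together.\<close>
  have "cross2 (B - A) (cevian_dir A B C s) = hnum s * cross2 (B - A) (C - A)"
    "cross2 (cevian_dir A B C s) (C - A) = hden s * cross2 (B - A) (C - A)"
    by (simp_all add: cevian_dir_def cross2_def algebra_simps)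
  then have "hnum s = 0" "hden s = 0"
    using * assms by (simp_all add: cross2_def)
  then show False
    by (cases s) auto
qed

text \<open>In the basis B - A, C - A the two directions have coordinates (q, p) and (-(p' + q'),
  q'), with determinant q q' + p p' + p q'.\<close>

lemma cross2_cevian_dir:
  "cross2 (cevian_dir A B C s) (cevian_dir B C A t) = hfactor s t * cross2 (B - A) (C - A)"
  by (simp add: cevian_dir_def cross2_def hfactor_def algebra_simps)

definition cevian_point :: "real^2 \<Rightarrow> real^2 \<Rightarrow> real^2 \<Rightarrow> xreal \<Rightarrow> xreal \<Rightarrow> real^2" where
  "cevian_point A B C s t = bary1 s t *\<^sub>R A + bary2 s t *\<^sub>R B + bary3 s t *\<^sub>R C"

text \<open>The parameters on the two lines come from comparing coefficients: those of B and C give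
  \<open>hden t / hfactor s t\<close> on the first line, those of C and A give
  \<open>hnum s / hfactor s t\<close> on the second.\<close>

lemma cevian_point_in_cevians:
  assumes "hfactor s t \<noteq> 0"
  shows "cevian_point A B C s t \<in> cevian A B C s \<inter> cevian B C A t"
proof -
  have "cevian_point A B C s t = A + (hden t / hfactor s t) *\<^sub>R cevian_dir A B C s"
    using assms
    by (simp add: cevian_point_def cevian_dir_def bary1_def bary2_def bary3_def vec_eq_iff field_simps)
      (simp add: hfactor_def algebra_simps)
  moreover have "cevian_point A B C s t = B + (hnum s / hfactor s t) *\<^sub>R cevian_dir B C A t"
    using assms
    by (simp add: cevian_point_def cevian_dir_def bary1_def bary2_def bary3_def vec_eq_iff field_simps)
      (simp add: hfactor_def algebra_simps)
  ultimately show ?thesis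
    unfolding cevian_eq_range by blast
qed

text \<open>A single common point forces independent directions, hence a nonzero factor by
  \<open>cross2_cevian_dir\<close>. Conversely, \<open>cevian_point\<close> is a common point and
  independence makes it the only one.\<close>

lemma cevians_unique_intersection_iff:
  assumes "cross2 (B - A) (C - A) \<noteq> 0"
  shows "(\<exists>!P. P \<in> cevian A B C s \<inter> cevian B C A t) \<longleftrightarrow> \<not> factor_vanishes s t"
proof
  assume "\<exists>!P. P \<in> cevian A B C s \<inter> cevian B C A t"
  moreover have "cevian_dir A B C s \<noteq> 0" "cevian_dir B C A t \<noteq> 0"
    using assms by (simp_all add: cevian_dir_nonzero cross2_rotate)
  ultimately have "cross2 (cevian_dir A B C s) (cevian_dir B C A t) \<noteq> 0"
    unfolding cevian_eq_range by (intro unique_intersection_imp_cross2_nonzero)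
  then show "\<not> factor_vanishes s t"
    by (auto simp: factor_vanishes_iff cross2_cevian_dir)
next
  assume "\<not> factor_vanishes s t"
  then have "hfactor s t \<noteq> 0"
    by (simp add: factor_vanishes_iff)
  moreover from this have "cross2 (cevian_dir A B C s) (cevian_dir B C A t) \<noteq> 0"
    using assms by (simp add: cross2_cevian_dir)
  ultimately show "\<exists>!P. P \<in> cevian A B C s \<inter> cevian B C A t"
    using cevian_point_in_cevians intersection_unique unfolding cevian_eq_range by metis
qed

lemma cevians_intersection_eq:
  assumes "cross2 (B - A) (C - A) \<noteq> 0" "cevian A B C s \<inter> cevian B C A t = {P}"
  shows "hfactor s t \<noteq> 0" and "P = cevian_point A B C s t"
proof -
  have "\<exists>!P. P \<in> cevian A B C s \<inter> cevian B C A t"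
    unfolding assms(2) by simp
  then show "hfactor s t \<noteq> 0"
    using cevians_unique_intersection_iff[OF assms(1)] by (simp add: factor_vanishes_iff)
  then show "P = cevian_point A B C s t"
    using cevian_point_in_cevians[of s t A B C] assms(2) by simp
qed

section \<open>The ratio of the areas\<close>

text \<open>The orientation is the sign of the same determinant whose absolute value is twice the
  area.\<close>

lemma signed_area_eq_cross2: "signed_area P Q R = cross2 (Q - P) (R - P) / 2"
proof -
  have "measure lebesgue (convex hull {P, Q, R}) = \<bar>cross2 (Q - P) (R - P)\<bar> / 2"
    by (simp add: content_triangle cross2_def abs_minus_commute mult.commute measure_completion
        compact_imp_closed finite_imp_compact_convex_hull)
  moreover have "orientation P Q R = sgn (cross2 (Q - P) (R - P))"
    by (simp add: orientation_def cross2_def)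
  ultimately show ?thesis
    by (simp only: signed_area_def times_divide_eq_right mult_sgn_abs)
qed

text \<open>The bracket is the 3 by 3 determinant of the barycentric coordinates, expanded along the
  row of P.\<close>

lemma cross2_barycentric:
  assumes "a1 + b1 + c1 = 1" "a2 + b2 + c2 = 1" "a3 + b3 + c3 = 1"
    and "P = a1 *\<^sub>R A + b1 *\<^sub>R B + c1 *\<^sub>R C"
    and "Q = a2 *\<^sub>R A + b2 *\<^sub>R B + c2 *\<^sub>R C"
    and "R = a3 *\<^sub>R A + b3 *\<^sub>R B + c3 *\<^sub>R C"
  shows "cross2 (Q - P) (R - P) =
    (a1 * (b2 * c3 - c2 * b3) - b1 * (a2 * c3 - c2 * a3) + c1 * (a2 * b3 - b2 * a3)) *
    cross2 (B - A) (C - A)"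
proof -
  \<comment> \<open>Eliminating the weights of A expresses Q - P and R - P through B - A and C -
    A.\<close>
  have "a1 = 1 - b1 - c1" "a2 = 1 - b2 - c2" "a3 = 1 - b3 - c3"
    using assms by auto
  then show ?thesis
    unfolding assms(4-6) by (simp add: cross2_def) (simp add: algebra_simps)
qed

text \<open>The coordinates of $Q$ and $R$ are shifted cyclically because \<^const>\<open>cevian_point\<close> refers to the
  triangles $BCA$ and $CAB$ there.\<close>

definition area_ratio :: "xreal \<times> xreal \<times> xreal \<times> xreal \<times> xreal \<times> xreal \<Rightarrow> real" where
  "area_ratio = (\<lambda>(x, y, z, u, v, w).
     bary1 x v * (bary1 y w * bary1 z u - bary2 y w * bary3 z u) -
     bary2 x v * (bary3 y w * bary1 z u - bary2 y w * bary2 z u) +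
     bary3 x v * (bary3 y w * bary3 z u - bary1 y w * bary2 z u))"

lemma signed_area_cevian_points:
  assumes "hfactor x v \<noteq> 0" "hfactor y w \<noteq> 0" "hfactor z u \<noteq> 0"
  shows "signed_area (cevian_point A B C x v) (cevian_point B C A y w) (cevian_point C A B z u) =
    area_ratio (x, y, z, u, v, w) * signed_area A B C"
proof -
  have "cross2 (cevian_point B C A y w - cevian_point A B C x v)
      (cevian_point C A B z u - cevian_point A B C x v) =
    area_ratio (x, y, z, u, v, w) * cross2 (B - A) (C - A)"
    unfolding area_ratio_def prod.case
    by (rule cross2_barycentric)
      (use assms[THEN bary_sum] in \<open>simp_all add: cevian_point_def algebra_simps\<close>)
  then show ?thesis
    by (simp add: signed_area_eq_cross2)
qed

section \<open>Extension by continuity\<close>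

lemma topspace_xreal_topology [simp]: "topspace xreal_topology = UNIV"
  by (auto simp: xreal_topology_def) (metis option.exhaust rangeI)

text \<open>Open sets containing infinity are the complements of closed compact sets of reals. The
  limit hypothesis makes the real part of the complement of a preimage bounded, hence
  compact.\<close>

lemma continuous_map_xreal:
  assumes cont: "continuous_on UNIV (\<lambda>t. f (Some t))"
    and lim: "((\<lambda>t. f (Some t)) \<longlongrightarrow> f None) at_infinity"
  shows "continuous_map xreal_topology euclideanreal f"
  unfolding continuous_map_def
proof (intro conjI allI impI)
  fix U :: "real set"
  assume "openin euclideanreal U"
  then have U: "open U" by simp
  define V where "V = {t. f (Some t) \<in> U}"
  have V: "open V"
    using open_vimage[OF U cont] by (simp add: V_def vimage_def)
  show "openin xreal_topology {s \<in> topspace xreal_topology. f s \<in> U}"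
  proof (cases "f None \<in> U")
    case True
    then have "\<forall>\<^sub>F t in at_infinity. t \<in> V"
      using topological_tendstoD[OF lim U] by (simp add: V_def)
    then obtain b where b: "\<And>t. b \<le> norm t \<Longrightarrow> t \<in> V"
      by (auto simp: eventually_at_infinity)
    have "- V \<subseteq> cball 0 b"
      using b by (auto simp del: real_norm_def) (meson linear)
    then have "compact (- V)"
      using V by (meson bounded_cball bounded_subset closed_Compl compact_eq_bounded_closed)
    moreover have "{s \<in> topspace xreal_topology. f s \<in> U} = insert None (Some ` (UNIV - (- V)))"
    proof -
      have "f s \<in> U \<longleftrightarrow> s = None \<or> s \<in> Some ` V" for s
        using True by (cases s) (auto simp: V_def)
      then show ?thesis by auto
    qed
    ultimately show ?thesis
      unfolding xreal_topology_def openin_Alexandroff_compactification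
      by (intro disjI2 exI[of _ "- V"]) (use V in \<open>auto simp: closed_Compl\<close>)
  next
    case False
    then have "f s \<in> U \<longleftrightarrow> s \<in> Some ` V" for s
      by (cases s) (auto simp: V_def)
    then have "{s \<in> topspace xreal_topology. f s \<in> U} = Some ` V"
      by auto
    then show ?thesis
      using V by (simp add: xreal_topology_def)
  qed
qed auto

text \<open>Entries of the orthogonal projection onto the line spanned by $(p, q)$; unlike $p$ and $q$, they
  are continuous on the projective line.\<close>

definition proj11 :: "xreal \<Rightarrow> real" where
  "proj11 s = hnum s ^ 2 / (hnum s ^ 2 + hden s ^ 2)"

definition proj12 :: "xreal \<Rightarrow> real" where
  "proj12 s = hnum s * hden s / (hnum s ^ 2 + hden s ^ 2)"

definition proj22 :: "xreal \<Rightarrow> real" where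
  "proj22 s = hden s ^ 2 / (hnum s ^ 2 + hden s ^ 2)"

text \<open>The values 1, 0, 0 at infinity must be the limits of the three rational functions at
  both ends of the real line.\<close>

lemma continuous_map_proj:
  "continuous_map xreal_topology euclideanreal proj11"
  "continuous_map xreal_topology euclideanreal proj12"
  "continuous_map xreal_topology euclideanreal proj22"
proof -
  have nz: "t\<^sup>2 + 1 \<noteq> 0" for t :: real
    using sum_power2_eq_zero_iff[of t 1] by simp
  have 1: "((\<lambda>t::real. t\<^sup>2 / (t\<^sup>2 + 1)) \<longlongrightarrow> 1) at_top"
    "((\<lambda>t::real. t\<^sup>2 / (t\<^sup>2 + 1)) \<longlongrightarrow> 1) at_bot"
    by real_asymp+
  have 2: "((\<lambda>t::real. t / (t\<^sup>2 + 1)) \<longlongrightarrow> 0) at_top"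
    "((\<lambda>t::real. t / (t\<^sup>2 + 1)) \<longlongrightarrow> 0) at_bot"
    by real_asymp+
  have 3: "((\<lambda>t::real. 1 / (t\<^sup>2 + 1)) \<longlongrightarrow> 0) at_top"
    "((\<lambda>t::real. 1 / (t\<^sup>2 + 1)) \<longlongrightarrow> 0) at_bot"
    by real_asymp+
  show "continuous_map xreal_topology euclideanreal proj11"
    using nz 1
    by (intro continuous_map_xreal)
      (auto simp: proj11_def at_infinity_eq_at_top_bot intro!: continuous_intros filterlim_sup)
  show "continuous_map xreal_topology euclideanreal proj12"
    using nz 2
    by (intro continuous_map_xreal)
      (auto simp: proj12_def at_infinity_eq_at_top_bot intro!: continuous_intros filterlim_sup)
  show "continuous_map xreal_topology euclideanreal proj22"
    using nz 3
    by (intro continuous_map_xreal)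
      (auto simp: proj22_def at_infinity_eq_at_top_bot intro!: continuous_intros filterlim_sup)
qed

text \<open>The expanded square of \<open>hfactor s t\<close> over the norms of both pairs. Squaring
  makes each monomial quadratic in (p, q) and in (p', q'), so it is a product of projection
  entries.\<close>

definition proj_factor :: "xreal \<Rightarrow> xreal \<Rightarrow> real" where
  "proj_factor s t = proj11 s * proj11 t + proj22 s * proj22 t + proj11 s * proj22 t +
     2 * (proj12 s * proj12 t) + 2 * (proj11 s * proj12 t) + 2 * (proj12 s * proj22 t)"

lemma hnorm_nonzero: "hnum s ^ 2 + hden s ^ 2 \<noteq> 0"
  using sum_power2_eq_zero_iff[of "hnum s" "hden s"] by (cases s) auto

lemma proj_factor_eq:
  "proj_factor s t = hfactor s t ^ 2 / ((hnum s ^ 2 + hden s ^ 2) * (hnum t ^ 2 + hden t ^ 2))"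
proof -
  define m n where "m = hnum s ^ 2 + hden s ^ 2" and "n = hnum t ^ 2 + hden t ^ 2"
  have "m \<noteq> 0" "n \<noteq> 0"
    using hnorm_nonzero by (simp_all add: m_def n_def)
  then show ?thesis
    unfolding proj_factor_def proj11_def proj12_def proj22_def hfactor_def m_def[symmetric] n_def[symmetric]
    by (simp add: field_simps power2_eq_square)
qed

lemma bary_eq_proj:
  assumes "hfactor s t \<noteq> 0"
  shows "bary1 s t = (proj11 s * proj11 t + proj12 s * proj12 t + proj11 s * proj12 t) / proj_factor s t"
    and "bary2 s t = (proj12 s * proj12 t + proj22 s * proj22 t + proj12 s * proj22 t) / proj_factor s t"
    and "bary3 s t = (proj11 s * proj12 t + proj12 s * proj22 t + proj11 s * proj22 t) / proj_factor s t"
proof -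
  define N where "N = (hnum s ^ 2 + hden s ^ 2) * (hnum t ^ 2 + hden t ^ 2)"
  have N: "N \<noteq> 0"
    using hnorm_nonzero by (simp add: N_def)
  \<comment> \<open>Expanding the fraction by \<open>hfactor s t / N\<close> makes its numerator
    quadratic in each pair as well.\<close>
  have eq: "h * k / hfactor s t = (h * k * hfactor s t / N) / proj_factor s t" for h k
    using N assms by (simp add: proj_factor_eq flip: N_def) (simp add: field_simps power2_eq_square)
  have "proj11 s * proj11 t + proj12 s * proj12 t + proj11 s * proj12 t = hnum s * hnum t * hfactor s t / N"
    "proj12 s * proj12 t + proj22 s * proj22 t + proj12 s * proj22 t = hden s * hden t * hfactor s t / N"
    "proj11 s * proj12 t + proj12 s * proj22 t + proj11 s * proj22 t = hnum s * hden t * hfactor s t / N"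
    unfolding proj11_def proj12_def proj22_def hfactor_def N_def
    by (simp_all add: times_divide_times_eq flip: add_divide_distrib)
      (simp_all add: power2_eq_square algebra_simps)
  then show "bary1 s t = (proj11 s * proj11 t + proj12 s * proj12 t + proj11 s * proj12 t) / proj_factor s t"
    "bary2 s t = (proj12 s * proj12 t + proj22 s * proj22 t + proj12 s * proj22 t) / proj_factor s t"
    "bary3 s t = (proj11 s * proj12 t + proj12 s * proj22 t + proj11 s * proj22 t) / proj_factor s t"
    using eq by (simp_all add: bary1_def bary2_def bary3_def)
qed

text \<open>Stated for arbitrary maps \<open>f\<close>, \<open>g\<close>, so that it applies to each
  of the three pairs of entries of a 6-tuple.\<close>

lemma continuous_map_bary:
  assumes f: "continuous_map X xreal_topology f" and g: "continuous_map X xreal_topology g"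
    and nz: "\<And>p. p \<in> topspace X \<Longrightarrow> hfactor (f p) (g p) \<noteq> 0"
  shows "continuous_map X euclideanreal (\<lambda>p. bary1 (f p) (g p))"
    and "continuous_map X euclideanreal (\<lambda>p. bary2 (f p) (g p))"
    and "continuous_map X euclideanreal (\<lambda>p. bary3 (f p) (g p))"
proof -
  have proj [continuous_intros]:
    "continuous_map X euclideanreal (\<lambda>p. proj11 (f p))" "continuous_map X euclideanreal (\<lambda>p. proj11 (g p))"
    "continuous_map X euclideanreal (\<lambda>p. proj12 (f p))" "continuous_map X euclideanreal (\<lambda>p. proj12 (g p))"
    "continuous_map X euclideanreal (\<lambda>p. proj22 (f p))" "continuous_map X euclideanreal (\<lambda>p. proj22 (g p))"
    using continuous_map_proj[THEN continuous_map_compose[OF f]]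
      continuous_map_proj[THEN continuous_map_compose[OF g]]
    by (simp_all add: o_def)
  have [continuous_intros]: "continuous_map X euclideanreal (\<lambda>p. proj_factor (f p) (g p))"
    unfolding proj_factor_def by (intro continuous_intros) auto
  have nz': "proj_factor (f p) (g p) \<noteq> 0" if "p \<in> topspace X" for p
    using nz[OF that] hnorm_nonzero by (simp add: proj_factor_eq)
  show "continuous_map X euclideanreal (\<lambda>p. bary1 (f p) (g p))"
    by (rule continuous_map_eq[where f = "\<lambda>p. (proj11 (f p) * proj11 (g p) + proj12 (f p) * proj12 (g p) +
          proj11 (f p) * proj12 (g p)) / proj_factor (f p) (g p)"])
      (auto intro!: continuous_intros nz' simp: bary_eq_proj nz)
  show "continuous_map X euclideanreal (\<lambda>p. bary2 (f p) (g p))"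
    by (rule continuous_map_eq[where f = "\<lambda>p. (proj12 (f p) * proj12 (g p) + proj22 (f p) * proj22 (g p) +
          proj12 (f p) * proj22 (g p)) / proj_factor (f p) (g p)"])
      (auto intro!: continuous_intros nz' simp: bary_eq_proj nz)
  show "continuous_map X euclideanreal (\<lambda>p. bary3 (f p) (g p))"
    by (rule continuous_map_eq[where f = "\<lambda>p. (proj11 (f p) * proj12 (g p) + proj12 (f p) * proj22 (g p) +
          proj11 (f p) * proj22 (g p)) / proj_factor (f p) (g p)"])
      (auto intro!: continuous_intros nz' simp: bary_eq_proj nz)
qed

lemma continuous_map_area_ratio:
  "continuous_map (subtopology xreal6_topology admissible) euclideanreal area_ratio"
proof -
  let ?X = "subtopology xreal6_topology admissible"
  define px py pz pu pv pw :: "xreal \<times> xreal \<times> xreal \<times> xreal \<times> xreal \<times> xreal \<Rightarrow> xreal"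
    where "px = fst" and "py = fst \<circ> snd" and "pz = fst \<circ> snd \<circ> snd"
      and "pu = fst \<circ> snd \<circ> snd \<circ> snd" and "pv = fst \<circ> snd \<circ> snd \<circ> snd \<circ> snd"
      and "pw = snd \<circ> snd \<circ> snd \<circ> snd \<circ> snd"
  note p_defs = px_def py_def pz_def pu_def pv_def pw_def
  have p: "continuous_map ?X xreal_topology px" "continuous_map ?X xreal_topology py"
    "continuous_map ?X xreal_topology pz" "continuous_map ?X xreal_topology pu"
    "continuous_map ?X xreal_topology pv" "continuous_map ?X xreal_topology pw"
    unfolding p_defs xreal6_topology_def
    by (rule continuous_map_from_subtopology,
        (rule continuous_map_fst continuous_map_snd continuous_map_compose)+)+
  \<comment> \<open>Restricting to admissible tuples is what keeps the denominators away from
    zero.\<close>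
  have nz: "hfactor (px q) (pv q) \<noteq> 0" "hfactor (py q) (pw q) \<noteq> 0" "hfactor (pz q) (pu q) \<noteq> 0"
    if "q \<in> topspace ?X" for q
    using that by (auto simp: admissible_def factor_vanishes_iff p_defs)
  note cont = continuous_map_bary[OF p(1) p(5) nz(1)] continuous_map_bary[OF p(2) p(6) nz(2)]
    continuous_map_bary[OF p(3) p(4) nz(3)]
  have eq: "area_ratio = (\<lambda>q.
     bary1 (px q) (pv q) * (bary1 (py q) (pw q) * bary1 (pz q) (pu q) - bary2 (py q) (pw q) * bary3 (pz q) (pu q)) -
     bary2 (px q) (pv q) * (bary3 (py q) (pw q) * bary1 (pz q) (pu q) - bary2 (py q) (pw q) * bary2 (pz q) (pu q)) +
     bary3 (px q) (pv q) * (bary3 (py q) (pw q) * bary3 (pz q) (pu q) - bary1 (py q) (pw q) * bary2 (pz q) (pu q)))"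
    by (auto simp: area_ratio_def p_defs fun_eq_iff)
  show ?thesis
    unfolding eq by (intro continuous_intros cont) auto
qed

text \<open>The three denominators factor out of the rows, leaving the determinant with rows (xv, 1,
  x), (y, yw, 1), (1, z, zu), which is the numerator of the formula.\<close>

lemma area_ratio_Some:
  assumes "(1 + x + x * v) * (1 + y + y * w) * (1 + z + z * u) \<noteq> 0"
  shows "area_ratio (Some x, Some y, Some z, Some u, Some v, Some w) = area_formula x y z u v w"
proof -
  define a b c where abc: "a = 1 + x + x * v" "b = 1 + y + y * w" "c = 1 + z + z * u"
  have "a \<noteq> 0" "b \<noteq> 0" "c \<noteq> 0"
    using assms by (auto simp: abc)
  then show ?thesis
    unfolding area_ratio_def area_formula_def bary1_def bary2_def bary3_def hfactor_Some prod.case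
      abc[symmetric]
    by (simp add: field_simps)
qed

lemma extends_area_ratio: "extends_area_formula area_ratio"
  unfolding extends_area_formula_def using continuous_map_area_ratio area_ratio_Some by blast

section \<open>Uniqueness of the extension\<close>

definition xapprox :: "xreal \<Rightarrow> nat \<Rightarrow> real" where
  "xapprox s n = (case s of None \<Rightarrow> real n | Some t \<Rightarrow> t)"

text \<open>A neighborhood of infinity misses only a bounded set of reals, which
  \<open>real n\<close> eventually leaves.\<close>

lemma xapprox_limit: "limitin xreal_topology (\<lambda>n. Some (xapprox s n)) s sequentially"
proof (cases s)
  case None
  show ?thesis
    unfolding limitin_def
  proof (intro conjI allI impI)
    fix U
    assume U: "openin xreal_topology U \<and> s \<in> U"
    then obtain K where K: "compact K" "U = insert None (Some ` (UNIV - K))"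
      using None by (auto simp: xreal_topology_def openin_Alexandroff_compactification)
    obtain b where b: "\<And>t. t \<in> K \<Longrightarrow> norm t \<le> b"
      using compact_imp_bounded[OF K(1)] by (auto simp: bounded_iff)
    have "\<forall>\<^sub>F n in sequentially. b < real n"
      by real_asymp
    then show "\<forall>\<^sub>F n in sequentially. Some (xapprox s n) \<in> U"
      by eventually_elim (use None K(2) b in \<open>force simp: xapprox_def\<close>)
  qed simp
next
  case (Some t)
  then show ?thesis by (simp add: xapprox_def)
qed

text \<open>With one infinite entry the factor is linear in n with slope 1 + b or a, nonzero by
  assumption, so it vanishes for at most one n. With two it is 1 + n + n^2 > 0, and with none it is
  constant.\<close>

lemma eventually_xapprox_not_vanishes:
  assumes "\<not> factor_vanishes s t"
  shows "\<forall>\<^sub>F n in sequentially. 1 + xapprox s n + xapprox s n * xapprox t n \<noteq> 0"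
proof (cases s)
  case s: None
  show ?thesis
  proof (cases t)
    case None
    have "1 + real n + real n * real n \<noteq> 0" for n
      by (metis add.assoc add_nonneg_nonneg add_pos_nonneg mult_nonneg_nonneg of_nat_0_le_iff
          order_less_irrefl zero_less_one)
    with s None show ?thesis by (simp add: xapprox_def)
  next
    case (Some b)
    with s assms have "1 + b \<noteq> 0"
      by (auto simp: factor_vanishes_iff hfactor_def)
    have "1 + real n + real n * b \<noteq> 0" if "n > \<bar>1 / (1 + b)\<bar>" for n
    proof
      assume "1 + real n + real n * b = 0"
      then have "real n * (1 + b) = - 1"
        by (simp add: algebra_simps)
      then have "real n = - (1 / (1 + b))"
        using \<open>1 + b \<noteq> 0\<close> by (simp add: field_simps)
      with that show False by linarith
    qed
    moreover have "\<forall>\<^sub>F n in sequentially. real n > \<bar>1 / (1 + b)\<bar>"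
      by real_asymp
    ultimately show ?thesis
      using s Some by (auto simp: xapprox_def elim: eventually_mono)
  qed
next
  case s: (Some a)
  show ?thesis
  proof (cases t)
    case None
    with s assms have "a \<noteq> 0"
      by (auto simp: factor_vanishes_iff hfactor_def)
    have "1 + a + a * real n \<noteq> 0" if "n > \<bar>(1 + a) / a\<bar>" for n
    proof
      assume "1 + a + a * real n = 0"
      then have "real n = - ((1 + a) / a)"
        using \<open>a \<noteq> 0\<close> by (simp add: field_simps)
      with that show False by linarith
    qed
    moreover have "\<forall>\<^sub>F n in sequentially. real n > \<bar>(1 + a) / a\<bar>"
      by real_asymp
    ultimately show ?thesis
      using s None by (auto simp: xapprox_def elim: eventually_mono)
  next
    case (Some b)
    with s assms show ?thesis
      by (simp add: xapprox_def factor_vanishes_iff)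
  qed
qed

text \<open>Along the real tuples \<open>S n\<close> both extensions eventually equal
  \<open>area_formula\<close>, and limits of real sequences are unique.\<close>

lemma extension_unique:
  assumes G: "extends_area_formula G" and H: "extends_area_formula H"
    and adm: "(x, y, z, u, v, w) \<in> admissible"
  shows "G (x, y, z, u, v, w) = H (x, y, z, u, v, w)"
proof -
  define S where "S n = (Some (xapprox x n), Some (xapprox y n), Some (xapprox z n),
    Some (xapprox u n), Some (xapprox v n), Some (xapprox w n))" for n
  let ?l = "(x, y, z, u, v, w)"
  have "\<forall>\<^sub>F n in sequentially.
      1 + xapprox x n + xapprox x n * xapprox v n \<noteq> 0 \<and>
      1 + xapprox y n + xapprox y n * xapprox w n \<noteq> 0 \<and>
      1 + xapprox z n + xapprox z n * xapprox u n \<noteq> 0"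
    using adm by (intro eventually_conj eventually_xapprox_not_vanishes) (auto simp: admissible_def)
  then have ev: "\<forall>\<^sub>F n in sequentially. S n \<in> admissible \<and> G (S n) = H (S n)"
  proof eventually_elim
    case (elim n)
    then show ?case
      using G H by (simp add: S_def admissible_def factor_vanishes_iff extends_area_formula_def)
  qed
  have "limitin xreal6_topology S ?l sequentially"
    using xapprox_limit by (simp add: xreal6_topology_def limitin_pairwise o_def S_def)
  \<comment> \<open>Continuity is known only on the subspace, where convergence also needs the terms
    to be eventually admissible.\<close>
  then have lim: "limitin (subtopology xreal6_topology admissible) S ?l sequentially"
    using adm ev by (auto simp: limitin_subtopology elim: eventually_mono)
  have "(\<lambda>n. G (S n)) \<longlonglongrightarrow> G ?l" "(\<lambda>n. H (S n)) \<longlonglongrightarrow> H ?l"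
    using G H continuous_map_limit[OF _ lim]
    by (auto simp: extends_area_formula_def o_def simp flip: limitin_canonical_iff)
  moreover from this(1) have "(\<lambda>n. H (S n)) \<longlonglongrightarrow> G ?l"
    by (rule Lim_transform_eventually) (use ev in \<open>auto elim: eventually_mono\<close>)
  ultimately show ?thesis
    by (blast intro: LIMSEQ_unique)
qed

theorem mainTheorem1:
  fixes A B C :: "real^2" and x y z u v w :: xreal
  assumes "\<not> collinear {A, B, C}"
  shows "((\<exists>!P. P \<in> cevian A B C x \<inter> cevian B C A v) \<and>
          (\<exists>!Q. Q \<in> cevian B C A y \<inter> cevian C A B w) \<and>
          (\<exists>!R. R \<in> cevian C A B z \<inter> cevian A B C u)
            \<longleftrightarrow> (x, y, z, u, v, w) \<in> admissible) \<and>
         (\<exists>G. extends_area_formula G) \<and>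
         (\<forall>P Q R G.
            cevian A B C x \<inter> cevian B C A v = {P} \<and>
            cevian B C A y \<inter> cevian C A B w = {Q} \<and>
            cevian C A B z \<inter> cevian A B C u = {R} \<and>
            extends_area_formula G \<longrightarrow>
            signed_area P Q R / signed_area A B C = G (x, y, z, u, v, w))"
proof -
  \<comment> \<open>The determinant is invariant under cyclic shifts, so the results for one pair of
    cevians apply to all three.\<close>
  have nz: "cross2 (B - A) (C - A) \<noteq> 0" "cross2 (C - B) (A - B) \<noteq> 0" "cross2 (A - C) (B - C) \<noteq> 0"
    using cross2_triangle_nonzero[OF assms] by (simp_all add: cross2_rotate)
  have "signed_area A B C \<noteq> 0"
    using nz by (simp add: signed_area_eq_cross2)
  have "signed_area P Q R / signed_area A B C = G (x, y, z, u, v, w)"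
    if P: "cevian A B C x \<inter> cevian B C A v = {P}"
      and Q: "cevian B C A y \<inter> cevian C A B w = {Q}"
      and R: "cevian C A B z \<inter> cevian A B C u = {R}"
      and G: "extends_area_formula G" for P Q R G
  proof -
    note factors = cevians_intersection_eq(1)[OF nz(1) P] cevians_intersection_eq(1)[OF nz(2) Q]
      cevians_intersection_eq(1)[OF nz(3) R]
    have "signed_area P Q R = area_ratio (x, y, z, u, v, w) * signed_area A B C"
      using signed_area_cevian_points[OF factors] cevians_intersection_eq(2)[OF nz(1) P]
        cevians_intersection_eq(2)[OF nz(2) Q] cevians_intersection_eq(2)[OF nz(3) R]
      by simp
    \<comment> \<open>\<open>area_ratio\<close> is itself an extension, so every other one agrees
      with it at this admissible tuple.\<close>
    moreover have "area_ratio (x, y, z, u, v, w) = G (x, y, z, u, v, w)"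
      using factors by (intro extension_unique extends_area_ratio G)
        (simp add: admissible_def factor_vanishes_iff)
    ultimately show ?thesis
      using \<open>signed_area A B C \<noteq> 0\<close> by simp
  qed
  then have "\<forall>P Q R G.
      cevian A B C x \<inter> cevian B C A v = {P} \<and>
      cevian B C A y \<inter> cevian C A B w = {Q} \<and>
      cevian C A B z \<inter> cevian A B C u = {R} \<and>
      extends_area_formula G \<longrightarrow>
      signed_area P Q R / signed_area A B C = G (x, y, z, u, v, w)"
    by blast
  moreover have "(x, y, z, u, v, w) \<in> admissible \<longleftrightarrow>
      \<not> factor_vanishes x v \<and> \<not> factor_vanishes y w \<and> \<not> factor_vanishes z u"
    by (simp add: admissible_def)
  ultimately show ?thesis
    unfolding cevians_unique_intersection_iff[OF nz(1)] cevians_unique_intersection_iff[OF nz(2)]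
      cevians_unique_intersection_iff[OF nz(3)]
    using extends_area_ratio by blast
qed

end
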